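(* Let $\mathbb{K}=(X,\dim,w)$ be a Lefschetz complex and let $f\colon\mathbb{K}\to\mathbb{R}$ be a discrete Morse-Bott function. The set $$-\nabla_s f=\{(\tau,\sigma)\in X\times X\mid w(\tau,\sigma)\neq0,\ f(\tau)<f(\sigma)\}$$ is a discrete vector field on $\mathbb{K}$.
   Context: A Lefschetz complex is a triple $\mathbb{K}=(X,\dim,w)$, where $X$ is a set (of cells), $\dim\colon X\to\mathbb{Z}_{\ge0}$ and $w\colon X\times X\to\mathbb{R}$ are functions, $\dim^{-1}(k)$ is finite for every $k$, and: (L1) $w(\tau,\sigma)\neq0$ implies $\dim\tau-\dim\sigma=1$; (L2) $\sum_{\sigma\in X}w(\tau,\sigma)w(\sigma,\nu)=0$ for all $\tau,\nu\in X$. For $f\colon\mathbb{K}\to\mathbb{R}$ and $\sigma\in\mathbb{K}$ put $U^{\mathrm{snc}}(\sigma)=\#\{\tau\in X\mid w(\tau,\sigma)\ne0,\ f(\sigma)>f(\tau)\}$ and $D^{\mathrm{snc}}(\sigma)=\#\{\nu\in X\mid w(\sigma,\nu)\ne0,\ f(\sigma)<f(\nu)\}$. $f$ is a discrete Morse-Bott function if $U^{\mathrm{snc}}(\sigma)\le1$ and $D^{\mathrm{snc}}(\sigma)\le1$ for every cell $\sigma$. A set $V\subset X\times X$ is a discrete vector field on $\mathbb{K}$ if (V1) $w(\tau,\sigma)\ne0$ for every $(\tau,\sigma)\in V$, and (V2) for any distinct pairs $(\tau,\sigma),(\widetilde\tau,\widetilde\sigma)\in V$, $\{\tau,\sigma\}\cap\{\widetilde\tau,\widetilde\sigma\}=\emptyset$.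 *)

theory Defs
  imports Complex_Main
begin

text \<open>The functions \<open>dim\<close> and \<open>w\<close> are total on the type of cells;
  only their values on \<open>X\<close> matter. \<open>X\<close> may be infinite, so the sum in (L2) is taken with
  \<open>sum'\<close>, the sum over the support of the summand. By (L1) and the finiteness of
  \<open>dim\<^sup>-\<^sup>1(k)\<close> this support is finite.\<close>

locale lefschetz_complex =
  fixes X :: "'a set" and dim :: "'a \<Rightarrow> nat" and w :: "'a \<Rightarrow> 'a \<Rightarrow> real"
  assumes finite_dim: "\<And>k. finite {\<sigma> \<in> X. dim \<sigma> = k}"
    and L1: "\<And>\<tau> \<sigma>. \<tau> \<in> X \<Longrightarrow> \<sigma> \<in> X \<Longrightarrow> w \<tau> \<sigma> \<noteq> 0 \<Longrightarrow> int (dim \<tau>) - int (dim \<sigma>) = 1"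
    and L2: "\<And>\<tau> \<nu>. \<tau> \<in> X \<Longrightarrow> \<nu> \<in> X \<Longrightarrow> sum' (\<lambda>\<sigma>. w \<tau> \<sigma> * w \<sigma> \<nu>) X = 0"

text \<open>In a Lefschetz complex the sets below are finite, again by (L1) and the finiteness of
  \<open>dim\<^sup>-\<^sup>1(k)\<close>, so \<open>card\<close> is the true number of elements.\<close>

definition U_snc :: "'a set \<Rightarrow> ('a \<Rightarrow> 'a \<Rightarrow> real) \<Rightarrow> ('a \<Rightarrow> real) \<Rightarrow> 'a \<Rightarrow> nat" where
  "U_snc X w f \<sigma> = card {\<tau> \<in> X. w \<tau> \<sigma> \<noteq> 0 \<and> f \<sigma> > f \<tau>}"

definition D_snc :: "'a set \<Rightarrow> ('a \<Rightarrow> 'a \<Rightarrow> real) \<Rightarrow> ('a \<Rightarrow> real) \<Rightarrow> 'a \<Rightarrow> nat" where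
  "D_snc X w f \<sigma> = card {\<nu> \<in> X. w \<sigma> \<nu> \<noteq> 0 \<and> f \<sigma> < f \<nu>}"

definition discrete_morse_bott :: "'a set \<Rightarrow> ('a \<Rightarrow> 'a \<Rightarrow> real) \<Rightarrow> ('a \<Rightarrow> real) \<Rightarrow> bool" where
  "discrete_morse_bott X w f \<longleftrightarrow> (\<forall>\<sigma>\<in>X. U_snc X w f \<sigma> \<le> 1 \<and> D_snc X w f \<sigma> \<le> 1)"

definition discrete_vector_field ::
    "'a set \<Rightarrow> ('a \<Rightarrow> 'a \<Rightarrow> real) \<Rightarrow> ('a \<times> 'a) set \<Rightarrow> bool" where
  "discrete_vector_field X w V \<longleftrightarrow>
     V \<subseteq> X \<times> X \<and>
     (\<forall>(\<tau>, \<sigma>)\<in>V. w \<tau> \<sigma> \<noteq> 0) \<and>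
     (\<forall>(\<tau>, \<sigma>)\<in>V. \<forall>(\<tau>', \<sigma>')\<in>V. (\<tau>, \<sigma>) \<noteq> (\<tau>', \<sigma>') \<longrightarrow> {\<tau>, \<sigma>} \<inter> {\<tau>', \<sigma>'} = {})"

definition neg_grad_s :: "'a set \<Rightarrow> ('a \<Rightarrow> 'a \<Rightarrow> real) \<Rightarrow> ('a \<Rightarrow> real) \<Rightarrow> ('a \<times> 'a) set" where
  "neg_grad_s X w f = {(\<tau>, \<sigma>) \<in> X \<times> X. w \<tau> \<sigma> \<noteq> 0 \<and> f \<tau> < f \<sigma>}"

end

theory Submission
  imports Defs
begin

text \<open>Two distinct pairs of the negative gradient can share a cell in two ways. If the shared cell
  has the same position in both, it has two facets with a larger value of \<open>f\<close> or two cofacets with a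
  smaller one, which the Morse--Bott bounds exclude.

  Otherwise the pairs form a chain \<open>(\<tau>, \<sigma>)\<close>, \<open>(\<sigma>, \<nu>)\<close> with \<open>f \<tau> < f \<sigma> < f \<nu>\<close>. Since
  \<open>w \<tau> \<sigma> * w \<sigma> \<nu> \<noteq> 0\<close>, the relation (L2) forces a second cell \<open>\<rho>\<close> between \<open>\<tau>\<close> and \<open>\<nu>\<close> so that the
  sum can cancel. The bound \<open>D_snc \<tau> \<le> 1\<close> is already used up by \<open>\<sigma>\<close>, hence \<open>f \<rho> \<le> f \<tau>\<close>; likewise
  \<open>U_snc \<nu> \<le> 1\<close> is used up by \<open>\<sigma>\<close>, hence \<open>f \<nu> \<le> f \<rho>\<close>. Together \<open>f \<nu> \<le> f \<tau>\<close>, a contradiction.\<close>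

context lefschetz_complex
begin

text \<open>The cofacets of \<open>\<sigma>\<close> all lie in the single dimension \<open>dim \<sigma> + 1\<close>. Finiteness matters because
  \<open>card\<close> is \<open>0\<close> on infinite sets, so a bound on it would otherwise say nothing.\<close>

lemma finite_cofacets:
  assumes "\<sigma> \<in> X"
  shows "finite {\<tau> \<in> X. w \<tau> \<sigma> \<noteq> 0}"
  by (rule finite_subset[OF _ finite_dim[of "Suc (dim \<sigma>)"]]) (use L1[OF _ assms] in fastforce)

lemma finite_facets:
  assumes "\<tau> \<in> X"
  shows "finite {\<sigma> \<in> X. w \<tau> \<sigma> \<noteq> 0}"
  by (rule finite_subset[OF _ finite_dim[of "dim \<tau> - 1"]]) (use L1[OF assms] in fastforce)

lemma U_snc_unique:
  assumes "discrete_morse_bott X w f" and "\<sigma> \<in> X"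
    and "\<tau> \<in> X" "w \<tau> \<sigma> \<noteq> 0" "f \<tau> < f \<sigma>"
    and "\<tau>' \<in> X" "w \<tau>' \<sigma> \<noteq> 0" "f \<tau>' < f \<sigma>"
  shows "\<tau> = \<tau>'"
proof -
  let ?U = "{\<tau> \<in> X. w \<tau> \<sigma> \<noteq> 0 \<and> f \<sigma> > f \<tau>}"
  have "finite ?U"
    by (rule finite_subset[OF _ finite_cofacets[OF assms(2)]]) auto
  moreover have "card ?U \<le> Suc 0"
    using assms(1,2) by (simp add: discrete_morse_bott_def U_snc_def)
  ultimately show ?thesis
    using assms by (simp add: card_le_Suc0_iff_eq)
qed

lemma D_snc_unique:
  assumes "discrete_morse_bott X w f" and "\<tau> \<in> X"
    and "\<sigma> \<in> X" "w \<tau> \<sigma> \<noteq> 0" "f \<tau> < f \<sigma>"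
    and "\<sigma>' \<in> X" "w \<tau> \<sigma>' \<noteq> 0" "f \<tau> < f \<sigma>'"
  shows "\<sigma> = \<sigma>'"
proof -
  let ?D = "{\<nu> \<in> X. w \<tau> \<nu> \<noteq> 0 \<and> f \<tau> < f \<nu>}"
  have "finite ?D"
    by (rule finite_subset[OF _ finite_facets[OF assms(2)]]) auto
  moreover have "card ?D \<le> Suc 0"
    using assms(1,2) by (simp add: discrete_morse_bott_def D_snc_def)
  ultimately show ?thesis
    using assms by (simp add: card_le_Suc0_iff_eq)
qed

text \<open>Were \<open>\<sigma>\<close> the only cell between \<open>\<tau>\<close> and \<open>\<nu>\<close>, the sum in (L2) would consist of one nonzero
  term.\<close>

lemma second_intermediate_cell:
  assumes "\<tau> \<in> X" "\<sigma> \<in> X" "\<nu> \<in> X" and "w \<tau> \<sigma> \<noteq> 0" "w \<sigma> \<nu> \<noteq> 0"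
  obtains \<rho> where "\<rho> \<in> X" "\<rho> \<noteq> \<sigma>" "w \<tau> \<rho> \<noteq> 0" "w \<rho> \<nu> \<noteq> 0"
proof (rule ccontr)
  assume "\<not> thesis"
  with that assms have "{\<rho> \<in> X. w \<tau> \<rho> * w \<rho> \<nu> \<noteq> 0} = {\<sigma>}"
    by auto
  then have "sum' (\<lambda>\<rho>. w \<tau> \<rho> * w \<rho> \<nu>) X = w \<tau> \<sigma> * w \<sigma> \<nu>"
    by (simp only: sum.G_def) simp
  with L2[OF assms(1,3)] assms(4,5) show False
    by simp
qed

lemma no_descending_chain:
  assumes "discrete_morse_bott X w f"
    and "\<tau> \<in> X" "\<sigma> \<in> X" "\<nu> \<in> X" and "w \<tau> \<sigma> \<noteq> 0" "w \<sigma> \<nu> \<noteq> 0"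
  shows "\<not> (f \<tau> < f \<sigma> \<and> f \<sigma> < f \<nu>)"
proof
  assume lt: "f \<tau> < f \<sigma> \<and> f \<sigma> < f \<nu>"
  obtain \<rho> where \<rho>: "\<rho> \<in> X" "\<rho> \<noteq> \<sigma>" "w \<tau> \<rho> \<noteq> 0" "w \<rho> \<nu> \<noteq> 0"
    using second_intermediate_cell assms(2-6) by blast
  have "f \<rho> \<le> f \<tau>"
    using D_snc_unique[of f \<tau> \<sigma> \<rho>] assms lt \<rho> by force
  moreover have "f \<nu> \<le> f \<rho>"
    using U_snc_unique[of f \<nu> \<sigma> \<rho>] assms lt \<rho> by force
  ultimately show False
    using lt by linarith
qed

end

theorem proposition4p3:
  fixes X :: "'a set" and dim :: "'a \<Rightarrow> nat" and w :: "'a \<Rightarrow> 'a \<Rightarrow> real"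
    and f :: "'a \<Rightarrow> real"
  assumes "lefschetz_complex X dim w"
    and "discrete_morse_bott X w f"
  shows "discrete_vector_field X w (neg_grad_s X w f)"
proof -
  interpret lefschetz_complex X dim w
    by (rule assms(1))
  have "{\<tau>, \<sigma>} \<inter> {\<tau>', \<sigma>'} = {}"
    if V: "(\<tau>, \<sigma>) \<in> neg_grad_s X w f" "(\<tau>', \<sigma>') \<in> neg_grad_s X w f"
      and ne: "(\<tau>, \<sigma>) \<noteq> (\<tau>', \<sigma>')" for \<tau> \<sigma> \<tau>' \<sigma>'
  proof -
    have *: "\<tau> \<in> X" "\<sigma> \<in> X" "w \<tau> \<sigma> \<noteq> 0" "f \<tau> < f \<sigma>"
      "\<tau>' \<in> X" "\<sigma>' \<in> X" "w \<tau>' \<sigma>' \<noteq> 0" "f \<tau>' < f \<sigma>'"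
      using V by (auto simp: neg_grad_s_def)
    have "\<tau> \<noteq> \<tau>'"
      using D_snc_unique[OF assms(2), of \<tau> \<sigma> \<sigma>'] * ne by blast
    moreover have "\<sigma> \<noteq> \<sigma>'"
      using U_snc_unique[OF assms(2), of \<sigma> \<tau> \<tau>'] * ne by blast
    moreover have "\<sigma> \<noteq> \<tau>'"
      using no_descending_chain[OF assms(2), of \<tau> \<sigma> \<sigma>'] * by blast
    moreover have "\<tau> \<noteq> \<sigma>'"
      using no_descending_chain[OF assms(2), of \<tau>' \<tau> \<sigma>] * by blast
    ultimately show ?thesis
      by blast
  qed
  then show ?thesis
    unfolding discrete_vector_field_def by (auto simp: neg_grad_s_def)
qed

end
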